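(* Let $a>0$, $0<\sigma<1$, $b<0$ and $-\sqrt a<X<\sqrt a$. Put $c=a-bX$ and consider the plane $\mathcal E=\{(x,y,z)\in\mathbb R^3: z=bx+c\}$ and the paraboloid segment $\mathcal P=\{(x,y,z)\in\mathbb R^3: x^2+y^2\le z\le a\}$ in left hand position, i.e. with submerged part $\mathcal P'=\mathcal P\cap\{z\ge bx+c\}$. Then this position is an equilibrium position of $\mathcal P$ for the density $\sigma$ if and only if $$F=0\quad\text{and}\quad E=0,$$ where $$F=V_1-V_2-\sigma V,\qquad E=\left(\frac{5b^2}{12}-\frac{2bX}{3}+\frac12\right)V_2+\frac{2b}{9}A^{5/2},$$ and $$V=\frac{a^2\pi}{2},\qquad A=a-X^2,\qquad a'=\frac{b^2}{4}-bX+a,\qquad X'=X-\frac b2,$$ $$V_1=\frac{a^2}{2}\left(\frac{\pi}{2}-\arctan\frac{X}{\sqrt A}\right)+\frac{2X^3-5aX}{6}\sqrt A,\qquad V_2=\frac{a'^2}{2}\left(\frac{\pi}{2}-\arctan\frac{X'}{\sqrt A}\right)+\frac{2X'^3-5a'X'}{6}\sqrt A .$$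
   Context: The homogeneous paraboloid segment $\mathcal P=\{x^2+y^2\le z\le a\}$ has density $\sigma$ with $0<\sigma<1$, and floats in a fluid of density $1$ whose surface is the plane $\mathcal E=\{z=bx+c\}$. The volume of $\mathcal P$ is $V=a^2\pi/2$ and its center of gravity is $B=(0,0,2a/3)$. The non-archimedean case is the case when $\mathcal E$ intersects the basis disk $\{x^2+y^2\le a,\ z=a\}$ of $\mathcal P$ in more than one point; it is characterized by $a=bX+c$ with $-\sqrt a<X<\sqrt a$. A left hand position means that the submerged part of $\mathcal P$ is $\mathcal P'=\mathcal P\cap\{z\ge bx+c\}$. Let $B'$ be the center of gravity of $\mathcal P'$ (with uniform mass distribution). The position is called an equilibrium position if both of the following hold: (i) (floating condition, Archimedes' principle) the volume of $\mathcal P'$ equals $\sigma V$; (ii) (equilibrium condition) the vector $B-B'$ is perpendicular to the plane $\mathcal E$, i.e. $B-B'$ is a real multiple of $(b,0,-1)$. *)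

theory Defs
  imports "HOL-Analysis.Analysis"
begin

definition paraboloid_segment :: "real \<Rightarrow> (real \<times> real \<times> real) set" where
  "paraboloid_segment a = {(x, y, z). x\<^sup>2 + y\<^sup>2 \<le> z \<and> z \<le> a}"

definition submerged_left :: "real \<Rightarrow> real \<Rightarrow> real \<Rightarrow> (real \<times> real \<times> real) set" where
  "submerged_left a b c = paraboloid_segment a \<inter> {(x, y, z). z \<ge> b * x + c}"

definition volume :: "'a::euclidean_space set \<Rightarrow> real" where
  "volume S = measure lborel S"

definition centroid :: "'a::euclidean_space set \<Rightarrow> 'a" where
  "centroid S = (1 / volume S) *\<^sub>R (LINT p:S|lborel. p)"

(* (b, 0, -1) is a normal vector of the plane z = b * x + c. *)
definition left_equilibrium :: "real \<Rightarrow> real \<Rightarrow> real \<Rightarrow> real \<Rightarrow> bool" where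
  "left_equilibrium a b c \<sigma> \<longleftrightarrow>
     volume (submerged_left a b c) = \<sigma> * volume (paraboloid_segment a) \<and>
     (\<exists>t. centroid (paraboloid_segment a) - centroid (submerged_left a b c) = t *\<^sub>R (b, 0, - 1))"

end

theory Submission
  imports Defs
begin

text \<open>
  Since \<open>b < 0\<close> and \<open>c = a - b X\<close>, the half-space \<open>x \<ge> X\<close> is exactly where the plane
  \<open>z = b x + c\<close> lies below the lid \<open>z = a\<close>. Hence the part of the paraboloid segment with
  \<open>x \<ge> X\<close> is the submerged body together with the piece of \<open>x \<ge> X\<close> between the paraboloid
  and the plane, and the two overlap only in that plane (\<open>set_integral_submerged_left\<close>). The
  full segment and the two pieces whose difference is the submerged body are instances of one
  shape, the piece of a half-space \<open>x \<ge> L\<close> between the paraboloid and a plane \<open>z = b x + c\<close>.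

  Completing the square shows that the vertical slice of this shape at \<open>x\<close> is a parabolic segment
  of half-width \<open>s\<close>, where \<open>s\<^sup>2 = r - w\<^sup>2\<close> with \<open>r = b\<^sup>2/4 + c\<close> and \<open>w = x - b/2\<close>. Integrating an
  affine function over the slice gives a combination of \<open>s\<^sup>3\<close>, \<open>w s\<^sup>3\<close> and \<open>s\<^sup>5\<close>. These have an
  antiderivative built from \<open>s\<^sup>5\<close>, \<open>w s\<^sup>5\<close> and an antiderivative of \<open>s\<^sup>3\<close>; up to its factor, the last
  one is the volume formula \<open>V\<^sub>1\<close> of the theorem (\<open>cap_volume\<close>). The result is
  \<open>oblique_segment_affine_integral\<close>, which contains the volume and all first moments at once. It
  is used with \<open>(r, w) = (a, X)\<close> for the horizontal lid and \<open>(r, w) = (a', X')\<close> for the oblique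
  plane. In both cases \<open>r - w\<^sup>2 = A\<close>, because the two shapes share the chord of the basis disk cut
  out by the plane.

  Thus the submerged volume is \<open>V\<^sub>1 - V\<^sub>2\<close>, so that \<open>F = 0\<close> is the floating condition. In
  the \<open>x\<close>-moment the \<open>A\<^bsup>5/2\<^esup>\<close> terms cancel. Eliminating the real multiple \<open>t\<close> from the
  perpendicularity condition and clearing the volume, which is positive when \<open>F = 0\<close>, leaves
  \<open>M\<^sub>x = b (2 a (V\<^sub>1 - V\<^sub>2) / 3 - M\<^sub>z)\<close> for the moments \<open>M\<^sub>x, M\<^sub>z\<close> of the submerged body
  (\<open>centroid_submerged_left_perpendicular_iff\<close>). The difference of the two sides is \<open>b E\<close> up to sign,
  and \<open>b \<noteq> 0\<close>.
\<close>

section \<open>Integration tools\<close>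

text \<open>Differentiability is demanded in the open interval only: the antiderivatives below contain
  \<open>arcsin\<close> and square roots, which are merely continuous at the boundary of the paraboloid.\<close>

lemma lborel_integral_FTC_interior:
  fixes f F :: "real \<Rightarrow> real"
  assumes "u \<le> v" and f: "continuous_on {u..v} f" and F: "continuous_on {u..v} F"
    and deriv: "\<And>x. u < x \<Longrightarrow> x < v \<Longrightarrow> (F has_real_derivative f x) (at x)"
  shows "(LINT x:{u..v}|lborel. f x) = F v - F u"
proof -
  have "set_integrable lborel {u..v} f"
    unfolding set_integrable_def by (rule borel_integrable_compact) (use f in auto)
  then have "(LINT x:{u..v}|lborel. f x) = integral {u..v} f"
    by (rule set_borel_integral_eq_integral)
  moreover have "(f has_integral (F v - F u)) {u..v}"
    using assms
    by (intro fundamental_theorem_of_calculus_interior)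
       (auto simp: has_real_derivative_iff_has_vector_derivative)
  ultimately show ?thesis by (simp add: integral_unique)
qed

text \<open>Fubini for the right-nested product gives the integrability of the two-dimensional sections
  only for almost every \<open>x\<close>, which is enough to split the inner integral once more.\<close>

lemma lborel_integral_iterated3:
  fixes f :: "real \<times> real \<times> real \<Rightarrow> real"
  assumes f: "integrable lborel f"
  shows "(LINT p|lborel. f p) = (LINT x|lborel. LINT y|lborel. LINT z|lborel. f (x, y, z))"
proof -
  have f': "integrable (lborel \<Otimes>\<^sub>M lborel) f"
    using f by (simp add: lborel_prod)
  have [measurable]: "f \<in> borel_measurable (lborel \<Otimes>\<^sub>M (lborel \<Otimes>\<^sub>M lborel))"
    using f by (simp add: lborel_prod)
  have "(LINT p|lborel. f p) = (LINT x|lborel. LINT q|lborel. f (x, q))"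
    using lborel_pair.integral_fst'[OF f'] by (simp add: lborel_prod)
  also have "\<dots> = (LINT x|lborel. LINT q|(lborel \<Otimes>\<^sub>M lborel). f (x, q))"
    by (simp add: lborel_prod)
  also have "\<dots> = (LINT x|lborel. LINT y|lborel. LINT z|lborel. f (x, y, z))"
  proof (rule integral_cong_AE)
    have "AE x in lborel. integrable lborel (\<lambda>q. f (x, q))"
      by (rule lborel_pair.AE_integrable_fst'[OF f'])
    then show "AE x in lborel. (LINT q|(lborel \<Otimes>\<^sub>M lborel). f (x, q))
        = (LINT y|lborel. LINT z|lborel. f (x, y, z))"
    proof eventually_elim
      case (elim x)
      then have "integrable (lborel \<Otimes>\<^sub>M lborel) (\<lambda>q. f (x, q))"
        by (simp add: lborel_prod)
      from lborel_pair.integral_fst'[OF this] show ?case by simp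
    qed
  qed measurable
  finally show ?thesis .
qed

lemma affine_integral_interval:
  fixes k \<delta> u v :: real
  assumes "u \<le> v"
  shows "(LINT z:{u..v}|lborel. k + \<delta> * z) = k * (v - u) + \<delta> / 2 * (v\<^sup>2 - u\<^sup>2)"
proof -
  have "(LINT z:{u..v}|lborel. k + \<delta> * z) = (k * v + \<delta> / 2 * v\<^sup>2) - (k * u + \<delta> / 2 * u\<^sup>2)"
    by (rule lborel_integral_FTC_interior[OF assms])
       (auto intro!: continuous_intros derivative_eq_intros simp: power2_eq_square)
  then show ?thesis by (simp add: algebra_simps)
qed

text \<open>The integrand is the integral of \<open>k + \<gamma> y + \<delta> z\<close> over the vertical segment from
  \<open>v - (s\<^sup>2 - y\<^sup>2)\<close> to \<open>v\<close>, that is, from the parabola to the line at height \<open>v\<close>.\<close>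

lemma parabolic_slice_integral:
  fixes k \<gamma> \<delta> v s :: real
  assumes "0 \<le> s"
  shows "(LINT y:{-s..s}|lborel. (k + \<gamma> * y) * (s\<^sup>2 - y\<^sup>2) + \<delta> / 2 * (v\<^sup>2 - (v - (s\<^sup>2 - y\<^sup>2))\<^sup>2))
    = 4 / 3 * (k + \<delta> * v) * s ^ 3 - 8 / 15 * \<delta> * s ^ 5"
proof -
  define P where "P y = (k + \<delta> * v) * (s\<^sup>2 * y - y ^ 3 / 3) + \<gamma> * (s\<^sup>2 * y\<^sup>2 / 2 - y ^ 4 / 4)
    - \<delta> / 2 * (s ^ 4 * y - 2 * s\<^sup>2 * y ^ 3 / 3 + y ^ 5 / 5)" for y
  have "(LINT y:{-s..s}|lborel. (k + \<gamma> * y) * (s\<^sup>2 - y\<^sup>2) + \<delta> / 2 * (v\<^sup>2 - (v - (s\<^sup>2 - y\<^sup>2))\<^sup>2)) = P s - P (- s)"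
  proof (rule lborel_integral_FTC_interior)
    show "(P has_real_derivative (k + \<gamma> * y) * (s\<^sup>2 - y\<^sup>2) + \<delta> / 2 * (v\<^sup>2 - (v - (s\<^sup>2 - y\<^sup>2))\<^sup>2)) (at y)" for y
      unfolding P_def
      by (rule derivative_eq_intros refl | simp)+
         (simp add: field_simps power2_eq_square power3_eq_cube power4_eq_xxxx)
  qed (use assms in \<open>auto simp: P_def intro!: continuous_intros\<close>)
  also have "\<dots> = 4 / 3 * (k + \<delta> * v) * s ^ 3 - 8 / 15 * \<delta> * s ^ 5"
    unfolding P_def by (simp add: field_simps) algebra
  finally show ?thesis .
qed

section \<open>The volume of a vertically cut paraboloid cap\<close>

text \<open>
  The volume of \<open>{x\<^sup>2 + y\<^sup>2 \<le> z \<le> r, x \<ge> w}\<close>. With \<open>arcsin\<close> in place of an \<open>arctan\<close> of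
  \<open>w / sqrt (r - w\<^sup>2)\<close> the expression stays continuous at \<open>w = \<plusminus> sqrt r\<close>, so that the full
  paraboloid segment is the case \<open>w = - sqrt r\<close>.
\<close>

definition cap_volume :: "real \<Rightarrow> real \<Rightarrow> real" where
  "cap_volume r w = r\<^sup>2 / 2 * (pi / 2 - arcsin (w / sqrt r)) + (2 * w ^ 3 - 5 * r * w) / 6 * sqrt (r - w\<^sup>2)"

lemma cap_volume_sqrt [simp]: "0 < r \<Longrightarrow> cap_volume r (sqrt r) = 0"
  by (simp add: cap_volume_def)

lemma cap_volume_minus_sqrt [simp]: "0 < r \<Longrightarrow> cap_volume r (- sqrt r) = r\<^sup>2 * pi / 2"
  by (simp add: cap_volume_def)

lemma power2_less_of_between_sqrt:
  assumes "- sqrt r < w" "w < sqrt r"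
  shows "w\<^sup>2 < r"
proof -
  have "\<bar>w\<bar> < sqrt r" using assms by auto
  then have "sqrt (w\<^sup>2) < sqrt r" by simp
  then show ?thesis by (simp only: real_sqrt_less_iff)
qed

lemma cap_volume_arctan:
  assumes "w\<^sup>2 < r"
  shows "cap_volume r w = r\<^sup>2 / 2 * (pi / 2 - arctan (w / sqrt (r - w\<^sup>2))) + (2 * w ^ 3 - 5 * r * w) / 6 * sqrt (r - w\<^sup>2)"
proof -
  have r: "0 < r" using assms zero_le_power2[of w] by linarith
  have "\<bar>w\<bar> < sqrt r" using assms by (metis real_sqrt_abs real_sqrt_less_iff)
  then have "- 1 < w / sqrt r" "w / sqrt r < 1" using r by (auto simp: field_simps)
  then have "arcsin (w / sqrt r) = arctan (w / sqrt r / sqrt (1 - (w / sqrt r)\<^sup>2))"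
    by (rule arcsin_arctan)
  also have "1 - (w / sqrt r)\<^sup>2 = (r - w\<^sup>2) / r" using r by (simp add: field_simps)
  also have "w / sqrt r / sqrt ((r - w\<^sup>2) / r) = w / sqrt (r - w\<^sup>2)"
    using r by (simp add: real_sqrt_divide)
  finally show ?thesis by (simp add: cap_volume_def)
qed

lemma sqrt_power2_diff_deriv:
  assumes "w\<^sup>2 < r"
  shows "((\<lambda>w. sqrt (r - w\<^sup>2)) has_real_derivative - w / sqrt (r - w\<^sup>2)) (at w)"
proof -
  have "((\<lambda>w. r - w\<^sup>2) has_real_derivative - (2 * w)) (at w)"
    by (auto intro!: derivative_eq_intros)
  moreover have "0 < r - w\<^sup>2" using assms by simp
  ultimately have "((\<lambda>w. sqrt (r - w\<^sup>2)) has_real_derivative inverse (sqrt (r - w\<^sup>2)) / 2 * - (2 * w)) (at w)"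
    by (intro DERIV_chain2[where f = sqrt and g = "\<lambda>w. r - w\<^sup>2"] DERIV_real_sqrt)
  moreover have "inverse t / 2 * - (2 * w) = - w / t" for t
    by (simp add: field_simps)
  ultimately show ?thesis by (simp only:)
qed

text \<open>Minus the area of the slice at \<open>w\<close>, a parabolic segment of half-width \<open>sqrt (r - w\<^sup>2)\<close>.\<close>

lemma cap_volume_deriv:
  assumes "w\<^sup>2 < r"
  shows "(cap_volume r has_real_derivative - 4 / 3 * sqrt (r - w\<^sup>2) ^ 3) (at w)"
proof -
  define s where "s = sqrt (r - w\<^sup>2)"
  have s: "0 < s" "s\<^sup>2 = r - w\<^sup>2" using assms by (auto simp: s_def)
  have r: "0 < r" using assms zero_le_power2[of w] by linarith
  have "\<bar>w\<bar> < sqrt r" using assms by (metis real_sqrt_abs real_sqrt_less_iff)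
  then have w: "- 1 < w / sqrt r" "w / sqrt r < 1" using r by (auto simp: field_simps)
  have "1 - (w / sqrt r)\<^sup>2 = (r - w\<^sup>2) / r" using r by (simp add: field_simps)
  then have sq: "sqrt (1 - (w / sqrt r)\<^sup>2) = s / sqrt r" by (simp add: s_def real_sqrt_divide)
  have arc: "((\<lambda>w. arcsin (w / sqrt r)) has_real_derivative 1 / s) (at w)"
  proof -
    have "((\<lambda>w. w / sqrt r) has_real_derivative 1 / sqrt r) (at w)"
      by (rule DERIV_cdivide[OF DERIV_ident])
    from DERIV_chain2[OF DERIV_arcsin[OF w] this] show ?thesis
      using r s sq by (simp add: field_simps)
  qed
  have poly: "((\<lambda>w. (2 * w ^ 3 - 5 * r * w) / 6) has_real_derivative (6 * w\<^sup>2 - 5 * r) / 6) (at w)"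
    by (auto intro!: derivative_eq_intros)
  have "(cap_volume r has_real_derivative r\<^sup>2 / 2 * (0 - 1 / s)
      + ((6 * w\<^sup>2 - 5 * r) / 6 * s + - w / s * ((2 * w ^ 3 - 5 * r * w) / 6))) (at w)"
    using DERIV_add[OF DERIV_cmult[OF DERIV_diff[OF DERIV_const[of "pi / 2"] arc], of "r\<^sup>2 / 2"]
        DERIV_mult[OF poly sqrt_power2_diff_deriv[OF assms]]]
    unfolding cap_volume_def[abs_def] s_def .
  moreover have "r\<^sup>2 / 2 * (0 - 1 / s)
      + ((6 * w\<^sup>2 - 5 * r) / 6 * s + - w / s * ((2 * w ^ 3 - 5 * r * w) / 6)) = - 4 / 3 * s ^ 3"
  proof -
    have "r = s\<^sup>2 + w\<^sup>2" using s by simp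
    then show ?thesis using s(1) by (simp add: field_simps power2_eq_square power3_eq_cube)
  qed
  ultimately show ?thesis by (simp add: s_def)
qed

lemma continuous_on_cap_volume:
  assumes "0 < r"
  shows "continuous_on {- sqrt r..sqrt r} (cap_volume r)"
proof -
  have arc: "continuous_on {- sqrt r..sqrt r} (\<lambda>w. arcsin (w / sqrt r))"
  proof (rule continuous_on_arcsin)
    show "\<forall>w\<in>{- sqrt r..sqrt r}. - 1 \<le> w / sqrt r \<and> w / sqrt r \<le> 1"
    proof
      fix w assume "w \<in> {- sqrt r..sqrt r}"
      then show "- 1 \<le> w / sqrt r \<and> w / sqrt r \<le> 1"
        using divide_right_mono[of "- sqrt r" w "sqrt r"] divide_right_mono[of w "sqrt r" "sqrt r"] assms
        by simp
    qed
    show "continuous_on {- sqrt r..sqrt r} (\<lambda>w. w / sqrt r)"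
      using assms by (intro continuous_intros) simp
  qed
  have "continuous_on {- sqrt r..sqrt r} (\<lambda>w. (2 * w ^ 3 - 5 * r * w) / 6 * sqrt (r - w\<^sup>2))"
    by (intro continuous_intros) simp
  from continuous_on_add[OF continuous_on_mult[OF continuous_on_const
        continuous_on_diff[OF continuous_on_const arc]] this]
  show ?thesis unfolding cap_volume_def[abs_def] .
qed

section \<open>Moments of the region between the paraboloid and a plane\<close>

definition oblique_segment :: "real \<Rightarrow> real \<Rightarrow> real \<Rightarrow> (real \<times> real \<times> real) set" where
  "oblique_segment b c L = {(x, y, z). L \<le> x \<and> x\<^sup>2 + y\<^sup>2 \<le> z \<and> z \<le> b * x + c}"

text \<open>Completing the square, the projection to the \<open>xy\<close>-plane lies in the disk of squared radius
  \<open>b\<^sup>2/4 + c\<close> around \<open>(b/2, 0)\<close>. Compactness makes every continuous function integrable over the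
  region.\<close>

lemma compact_oblique_segment: "compact (oblique_segment b c L)"
proof (rule compact_eq_bounded_closed[THEN iffD2], rule conjI)
  define r where "r = b\<^sup>2 / 4 + c"
  define m where "m = \<bar>b / 2\<bar> + sqrt \<bar>r\<bar>"
  have "oblique_segment b c L \<subseteq> cbox (- m, - m, 0) (m, m, \<bar>b\<bar> * m + \<bar>c\<bar>)"
  proof
    fix p assume "p \<in> oblique_segment b c L"
    then obtain x y z where p: "p = (x, y, z)" and *: "x\<^sup>2 + y\<^sup>2 \<le> z" "z \<le> b * x + c"
      by (auto simp: oblique_segment_def)
    from * have disc: "(x - b / 2)\<^sup>2 + y\<^sup>2 \<le> r"
      by (simp add: r_def power2_eq_square algebra_simps)
    have "(x - b / 2)\<^sup>2 \<le> \<bar>r\<bar>" "y\<^sup>2 \<le> \<bar>r\<bar>"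
      using disc zero_le_power2[of y] zero_le_power2[of "x - b / 2"] by linarith+
    then have "\<bar>x - b / 2\<bar> \<le> sqrt \<bar>r\<bar>" "\<bar>y\<bar> \<le> sqrt \<bar>r\<bar>"
      by (metis real_sqrt_abs real_sqrt_le_iff)+
    then have xy: "\<bar>x\<bar> \<le> m" "\<bar>y\<bar> \<le> m" by (auto simp: m_def)
    moreover have "b * x \<le> \<bar>b\<bar> * m"
      using mult_mono[of "\<bar>b\<bar>" "\<bar>b\<bar>" "\<bar>x\<bar>" m] xy by (simp add: abs_mult[symmetric])
    moreover have "0 \<le> z" using * zero_le_power2[of x] zero_le_power2[of y] by linarith
    ultimately show "p \<in> cbox (- m, - m, 0) (m, m, \<bar>b\<bar> * m + \<bar>c\<bar>)"
      using *(2) by (auto simp: p)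
  qed
  then show "bounded (oblique_segment b c L)"
    using bounded_cbox bounded_subset by blast
  have "oblique_segment b c L = {p. L \<le> fst p} \<inter> {p. (fst p)\<^sup>2 + (fst (snd p))\<^sup>2 \<le> snd (snd p)}
      \<inter> {p. snd (snd p) \<le> b * fst p + c}"
    by (auto simp: oblique_segment_def)
  also have "closed \<dots>"
    by (intro closed_Int closed_Collect_le continuous_intros)
  finally show "closed (oblique_segment b c L)" .
qed

text \<open>For fixed \<open>x\<close> the points of the region satisfy \<open>x\<^sup>2 + y\<^sup>2 \<le> z \<le> v\<close> with \<open>v = b x + c\<close>, and
  \<open>v - x\<^sup>2 = b\<^sup>2/4 + c - (x - b/2)\<^sup>2\<close> is the square of the half-width of this slice.\<close>

lemma oblique_segment_slice_integral:
  fixes \<alpha> \<beta> \<gamma> \<delta> b c x :: real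
  assumes "(x - b / 2)\<^sup>2 \<le> b\<^sup>2 / 4 + c"
  shows "(LINT y|lborel. LINT z|lborel. indicator {(x, y, z). x\<^sup>2 + y\<^sup>2 \<le> z \<and> z \<le> b * x + c} (x, y, z)
      *\<^sub>R (\<alpha> + \<beta> * x + \<gamma> * y + \<delta> * z))
    = 4 / 3 * (\<alpha> + \<beta> * x + \<delta> * (b * x + c)) * sqrt (b\<^sup>2 / 4 + c - (x - b / 2)\<^sup>2) ^ 3
      - 8 / 15 * \<delta> * sqrt (b\<^sup>2 / 4 + c - (x - b / 2)\<^sup>2) ^ 5"
proof -
  define s where "s = sqrt (b\<^sup>2 / 4 + c - (x - b / 2)\<^sup>2)"
  define v where "v = b * x + c"
  have s: "0 \<le> s" "s\<^sup>2 = v - x\<^sup>2"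
    using assms by (auto simp: s_def v_def power2_eq_square algebra_simps)
  have "(LINT z|lborel. indicator {(x, y, z). x\<^sup>2 + y\<^sup>2 \<le> z \<and> z \<le> b * x + c} (x, y, z)
      *\<^sub>R (\<alpha> + \<beta> * x + \<gamma> * y + \<delta> * z))
    = indicator {-s..s} y *\<^sub>R ((\<alpha> + \<beta> * x + \<gamma> * y) * (s\<^sup>2 - y\<^sup>2) + \<delta> / 2 * (v\<^sup>2 - (v - (s\<^sup>2 - y\<^sup>2))\<^sup>2))" for y
  proof -
    have "(LINT z|lborel. indicator {(x, y, z). x\<^sup>2 + y\<^sup>2 \<le> z \<and> z \<le> b * x + c} (x, y, z)
        *\<^sub>R (\<alpha> + \<beta> * x + \<gamma> * y + \<delta> * z))
      = (LINT z:{x\<^sup>2 + y\<^sup>2..v}|lborel. (\<alpha> + \<beta> * x + \<gamma> * y) + \<delta> * z)"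
      unfolding set_lebesgue_integral_def v_def
      by (intro Bochner_Integration.integral_cong) (auto simp: indicator_def)
    also have "\<dots> = indicator {-s..s} y *\<^sub>R ((\<alpha> + \<beta> * x + \<gamma> * y) * (s\<^sup>2 - y\<^sup>2) + \<delta> / 2 * (v\<^sup>2 - (v - (s\<^sup>2 - y\<^sup>2))\<^sup>2))"
    proof (cases "\<bar>y\<bar> \<le> s")
      case True
      then have "y\<^sup>2 \<le> s\<^sup>2" using abs_le_square_iff[of y s] s(1) by simp
      then have "x\<^sup>2 + y\<^sup>2 \<le> v" using s(2) by linarith
      from affine_integral_interval[OF this] show ?thesis
        using True s(2) by (auto simp: indicator_def)
    next
      case False
      then have "s\<^sup>2 < y\<^sup>2" using abs_le_square_iff[of y s] s(1) by simp
      then have "v < x\<^sup>2 + y\<^sup>2" using s(2) by linarith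
      then show ?thesis using False by (auto simp: indicator_def set_lebesgue_integral_def)
    qed
    finally show ?thesis .
  qed
  then show ?thesis
    using parabolic_slice_integral[OF s(1), of "\<alpha> + \<beta> * x" \<gamma> \<delta> v]
    by (simp add: set_lebesgue_integral_def s_def[symmetric] v_def[symmetric])
qed

text \<open>With \<open>s = sqrt (r - w\<^sup>2)\<close>, the slice integrals combine \<open>s\<^sup>3\<close>, \<open>w s\<^sup>3\<close> and \<open>s\<^sup>5\<close>. The
  first is minus the derivative of the cap volume up to the factor 4/3 and the second comes from
  \<open>(s\<^sup>5)' = - 5 w s\<^sup>3\<close>. Because of \<open>(w s\<^sup>5)' = 6 s\<^sup>5 - 5 r s\<^sup>3\<close>, the third reduces to the first,
  which leaves the term \<open>w s\<^sup>5\<close>.\<close>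

lemma oblique_segment_affine_integral:
  fixes \<alpha> \<beta> \<gamma> \<delta> b c L :: real
  defines "r \<equiv> b\<^sup>2 / 4 + c"
  defines "w \<equiv> L - b / 2"
  defines "q \<equiv> \<beta> + b * \<delta>"
  assumes r: "0 < r" and w: "- sqrt r \<le> w" "w \<le> sqrt r"
  shows "(LINT p:oblique_segment b c L|lborel. \<alpha> + \<beta> * fst p + \<gamma> * fst (snd p) + \<delta> * snd (snd p))
    = (\<alpha> + b / 2 * q + \<delta> * (2 / 3 * r - b\<^sup>2 / 4)) * cap_volume r w
      + (4 / 15 * q + 4 / 45 * \<delta> * w) * sqrt (r - w\<^sup>2) ^ 5"
proof -
  let ?g = "\<lambda>p. \<alpha> + \<beta> * fst p + \<gamma> * fst (snd p) + \<delta> * snd (snd p)"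
  let ?S = "oblique_segment b c L"
  let ?s = "\<lambda>x. sqrt (r - (x - b / 2)\<^sup>2)"
  let ?h = "\<lambda>x. 4 / 3 * (\<alpha> + \<beta> * x + \<delta> * (b * x + c)) * ?s x ^ 3 - 8 / 15 * \<delta> * ?s x ^ 5"
  define p where "p = \<alpha> + b / 2 * q + \<delta> * (2 / 3 * r - b\<^sup>2 / 4)"
  define \<Phi> where "\<Phi> x = - p * cap_volume r (x - b / 2)
    - (4 / 15 * q + 4 / 45 * \<delta> * (x - b / 2)) * ?s x ^ 5" for x
  have g: "continuous_on UNIV ?g"
    by (intro continuous_intros)
  have "integrable lborel (\<lambda>p. indicator ?S p *\<^sub>R ?g p)"
    by (rule borel_integrable_compact[OF compact_oblique_segment continuous_on_subset[OF g]]) simp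
  from lborel_integral_iterated3[OF this]
  have "(LINT p:?S|lborel. ?g p) = (LINT x|lborel. LINT y|lborel. LINT z|lborel.
      indicator ?S (x, y, z) *\<^sub>R (\<alpha> + \<beta> * x + \<gamma> * y + \<delta> * z))"
    by (simp add: set_lebesgue_integral_def)
  also have "\<dots> = (LINT x:{L..b / 2 + sqrt r}|lborel. ?h x)"
    unfolding set_lebesgue_integral_def
  proof (rule Bochner_Integration.integral_cong[OF refl])
    fix x :: real
    show "(LINT y|lborel. LINT z|lborel.
        indicator ?S (x, y, z) *\<^sub>R (\<alpha> + \<beta> * x + \<gamma> * y + \<delta> * z))
      = indicator {L..b / 2 + sqrt r} x *\<^sub>R ?h x"
    \<comment> \<open>beyond \<open>b / 2 + sqrt r\<close> the plane lies below the paraboloid and the slice is empty\<close>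
    proof (cases "x \<in> {L..b / 2 + sqrt r}")
      case True
      then have "\<bar>x - b / 2\<bar> \<le> sqrt r" using w by (auto simp: w_def)
      then have "(x - b / 2)\<^sup>2 \<le> r" by (metis real_sqrt_abs real_sqrt_le_iff)
      from oblique_segment_slice_integral[OF this[unfolded r_def], of \<alpha> \<beta> \<gamma> \<delta>] True
      show ?thesis by (simp add: oblique_segment_def r_def indicator_def)
    next
      case False
      have "(x, y, z) \<notin> ?S" for y z
      proof
        assume "(x, y, z) \<in> ?S"
        then have *: "L \<le> x" "x\<^sup>2 + y\<^sup>2 \<le> z" "z \<le> b * x + c" by (auto simp: oblique_segment_def)
        then have "(x - b / 2)\<^sup>2 + y\<^sup>2 \<le> r" by (simp add: r_def power2_eq_square algebra_simps)
        then have "(x - b / 2)\<^sup>2 \<le> r" using zero_le_power2[of y] by linarith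
        then have "\<bar>x - b / 2\<bar> \<le> sqrt r" by (metis real_sqrt_abs real_sqrt_le_iff)
        with * False show False by auto
      qed
      with False show ?thesis by simp
    qed
  qed
  also have "\<dots> = \<Phi> (b / 2 + sqrt r) - \<Phi> L"
  proof (rule lborel_integral_FTC_interior)
    show "L \<le> b / 2 + sqrt r" using w by (simp add: w_def)
    show "continuous_on {L..b / 2 + sqrt r} ?h" by (intro continuous_intros)
    have "continuous_on {L..b / 2 + sqrt r} (\<lambda>x. cap_volume r (x - b / 2))"
      by (rule continuous_on_compose2[OF continuous_on_cap_volume[OF r]])
         (use w in \<open>auto simp: w_def intro!: continuous_intros\<close>)
    then show "continuous_on {L..b / 2 + sqrt r} \<Phi>"
      unfolding \<Phi>_def by (intro continuous_intros)
    fix x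
    assume "L < x" "x < b / 2 + sqrt r"
    then have "- sqrt r < x - b / 2" "x - b / 2 < sqrt r" using w by (auto simp: w_def)
    then have x: "(x - b / 2)\<^sup>2 < r" by (rule power2_less_of_between_sqrt)
    define s where "s = ?s x"
    have s: "0 < s" "s\<^sup>2 = r - (x - b / 2)\<^sup>2" using x by (auto simp: s_def)
    have sh: "((\<lambda>x. x - b / 2) has_real_derivative 1) (at x)"
      by (auto intro!: derivative_eq_intros)
    have cap: "((\<lambda>x. cap_volume r (x - b / 2)) has_real_derivative - 4 / 3 * s ^ 3) (at x)"
      using DERIV_chain2[OF cap_volume_deriv[OF x] sh] by (simp add: s_def)
    have "(?s has_real_derivative - (x - b / 2) / s) (at x)"
      using DERIV_chain2[OF sqrt_power2_diff_deriv[OF x] sh] by (simp only: s_def mult_1_right)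
    from DERIV_power[OF this, of 5]
    have "((\<lambda>x. ?s x ^ 5) has_real_derivative of_nat 5 * (- (x - b / 2) / s * s ^ (5 - Suc 0))) (at x)"
      by (simp only: s_def)
    moreover have "of_nat 5 * (- (x - b / 2) / s * s ^ (5 - Suc 0)) = - 5 * (x - b / 2) * s ^ 3"
      using s(1) by (simp add: eval_nat_numeral)
    ultimately have pow5: "((\<lambda>x. ?s x ^ 5) has_real_derivative - 5 * (x - b / 2) * s ^ 3) (at x)"
      by (simp only:)
    have "((\<lambda>x. 4 / 15 * q + 4 / 45 * \<delta> * (x - b / 2)) has_real_derivative 4 / 45 * \<delta>) (at x)"
      by (auto intro!: derivative_eq_intros)
    from DERIV_diff[OF DERIV_cmult[OF cap, of "- p"] DERIV_mult[OF this pow5]]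
    have "(\<Phi> has_real_derivative - p * (- 4 / 3 * s ^ 3)
        - (4 / 45 * \<delta> * s ^ 5
          + (- 5 * (x - b / 2) * s ^ 3) * (4 / 15 * q + 4 / 45 * \<delta> * (x - b / 2)))) (at x)"
      unfolding \<Phi>_def[abs_def] s_def .
    moreover have "- p * (- 4 / 3 * s ^ 3) - (4 / 45 * \<delta> * s ^ 5
          + (- 5 * (x - b / 2) * s ^ 3) * (4 / 15 * q + 4 / 45 * \<delta> * (x - b / 2)))
      = 4 / 3 * (\<alpha> + \<beta> * x + \<delta> * (b * x + c)) * s ^ 3 - 8 / 15 * \<delta> * s ^ 5"
    proof -
      \<comment> \<open>writing \<open>s ^ 5\<close> as a multiple of \<open>s ^ 3\<close> leaves an identity of quadratic polynomials in \<open>x\<close>\<close>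
      have "s ^ 5 = s\<^sup>2 * s ^ 3" by (simp flip: power_add)
      then have s5: "s ^ 5 = (r - (x - b / 2)\<^sup>2) * s ^ 3" by (simp only: s(2))
      show ?thesis unfolding s5 p_def q_def r_def by (simp add: power2_eq_square field_simps)
    qed
    ultimately show "(\<Phi> has_real_derivative ?h x) (at x)" by (simp add: s_def)
  qed
  also have "\<dots> = p * cap_volume r w + (4 / 15 * q + 4 / 45 * \<delta> * w) * sqrt (r - w\<^sup>2) ^ 5"
    using r by (simp add: \<Phi>_def w_def)
  finally show ?thesis by (simp add: p_def)
qed

lemma oblique_segment_moments:
  fixes b c L :: real
  defines "r \<equiv> b\<^sup>2 / 4 + c"
  defines "w \<equiv> L - b / 2"
  defines "T \<equiv> sqrt (r - w\<^sup>2) ^ 5"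
  assumes r: "0 < r" and w: "- sqrt r \<le> w" "w \<le> sqrt r"
  shows "(LINT p:oblique_segment b c L|lborel. 1) = cap_volume r w"
    and "(LINT p:oblique_segment b c L|lborel. fst p) = b / 2 * cap_volume r w + 4 / 15 * T"
    and "(LINT p:oblique_segment b c L|lborel. fst (snd p)) = 0"
    and "(LINT p:oblique_segment b c L|lborel. snd (snd p))
      = (b\<^sup>2 / 4 + 2 / 3 * r) * cap_volume r w + (4 / 15 * b + 4 / 45 * w) * T"
proof -
  note affine = oblique_segment_affine_integral[of b c L, folded r_def w_def, OF r w, folded T_def]
  show "(LINT p:oblique_segment b c L|lborel. 1) = cap_volume r w"
    using affine[of 1 0 0 0] by simp
  show "(LINT p:oblique_segment b c L|lborel. fst p) = b / 2 * cap_volume r w + 4 / 15 * T"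
    using affine[of 0 1 0 0] by simp
  show "(LINT p:oblique_segment b c L|lborel. fst (snd p)) = 0"
    using affine[of 0 0 1 0] by simp
  have "b / 2 * b + (2 / 3 * r - b\<^sup>2 / 4) = b\<^sup>2 / 4 + 2 / 3 * r"
    by (simp add: power2_eq_square)
  then show "(LINT p:oblique_segment b c L|lborel. snd (snd p))
      = (b\<^sup>2 / 4 + 2 / 3 * r) * cap_volume r w + (4 / 15 * b + 4 / 45 * w) * T"
    using affine[of 0 0 0 1] by simp
qed

section \<open>The floating body\<close>

lemma paraboloid_segment_eq_oblique_segment:
  assumes "0 < a"
  shows "paraboloid_segment a = oblique_segment 0 a (- sqrt a)"
proof -
  have "- sqrt a \<le> x" if "x\<^sup>2 + y\<^sup>2 \<le> z" "z \<le> a" for x y z :: real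
  proof -
    have "x\<^sup>2 \<le> a" using that zero_le_power2[of y] by linarith
    then have "\<bar>x\<bar> \<le> sqrt a" by (metis real_sqrt_abs real_sqrt_le_iff)
    then show ?thesis by simp
  qed
  then show ?thesis by (auto simp: paraboloid_segment_def oblique_segment_def)
qed

lemma compact_submerged_left:
  assumes "0 < a"
  shows "compact (submerged_left a b c)"
proof -
  have "{(x, y :: real, z). b * x + c \<le> z} = {p. b * fst p + c \<le> snd (snd p)}"
    by auto
  also have "closed \<dots>"
    by (intro closed_Collect_le continuous_intros)
  finally show ?thesis
    unfolding submerged_left_def paraboloid_segment_eq_oblique_segment[OF assms]
    by (intro compact_Int_closed compact_oblique_segment)
qed

text \<open>The two regions cut off by the plane cover the part \<open>x \<ge> X\<close> of the paraboloid segment and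
  meet only in the plane, a null set.\<close>

lemma set_integral_submerged_left:
  fixes g :: "real \<times> real \<times> real \<Rightarrow> real"
  assumes "0 < a" "b < 0" and c: "c = a - b * X" and g: "continuous_on UNIV g"
  shows "(LINT p:submerged_left a b c|lborel. g p)
    = (LINT p:oblique_segment 0 a X|lborel. g p) - (LINT p:oblique_segment b c X|lborel. g p)"
proof -
  let ?P = "submerged_left a b c" and ?S = "oblique_segment b c X"
  \<comment> \<open>this equivalence is where the sign of \<open>b\<close> (the left hand position) enters\<close>
  have X: "X \<le> x \<longleftrightarrow> b * x + c \<le> a" for x
    using \<open>b < 0\<close> by (simp add: c mult_le_cancel_left_neg flip: mult_less_cancel_left)
  have union: "?P \<union> ?S = oblique_segment 0 a X"
    unfolding submerged_left_def paraboloid_segment_def oblique_segment_def X by auto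
  have int: "set_integrable lborel K g" if "compact K" for K
    unfolding set_integrable_def
    by (rule borel_integrable_compact[OF that continuous_on_subset[OF g]]) simp
  have sets: "K \<in> sets lborel" if "compact K" for K :: "(real \<times> real \<times> real) set"
    using that by (simp add: borel_compact)
  let ?H = "{p. (b, 0, - 1) \<bullet> p = - c}"
  have "negligible ?H" by (rule negligible_hyperplane) (use \<open>b < 0\<close> in \<open>simp add: zero_prod_def\<close>)
  moreover have "?H \<in> sets borel" by (intro borel_closed closed_hyperplane)
  ultimately have "?H \<in> null_sets lborel"
    by (simp add: negligible_iff_null_sets null_sets_completion_iff)
  from AE_not_in[OF this] have "AE p in lborel. \<not> (p \<in> ?P \<and> p \<in> ?S)"
    by eventually_elim (auto simp: submerged_left_def oblique_segment_def)
  from set_integral_Un_AE[OF this sets sets int int,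
      OF compact_submerged_left[OF \<open>0 < a\<close>] compact_oblique_segment
        compact_submerged_left[OF \<open>0 < a\<close>] compact_oblique_segment]
  show ?thesis by (simp add: union)
qed

lemma volume_eq_set_integral: "volume S = (LINT p:S|lborel. 1)"
  by (simp add: volume_def set_lebesgue_integral_def)

lemma centroid_compact:
  fixes S :: "(real \<times> real \<times> real) set"
  assumes "compact S"
  shows "centroid S = (1 / volume S) *\<^sub>R
    ((LINT p:S|lborel. fst p), (LINT p:S|lborel. fst (snd p)), (LINT p:S|lborel. snd (snd p)))"
proof -
  have int: "integrable lborel (\<lambda>p. indicator S p *\<^sub>R p)"
    by (rule borel_integrable_compact[OF assms]) (intro continuous_intros)
  have "f (LINT p:S|lborel. p) = (LINT p:S|lborel. f p)"
    if f: "bounded_linear f" for f :: "real \<times> real \<times> real \<Rightarrow> real"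
    unfolding set_lebesgue_integral_def
    using integral_bounded_linear[OF f int] by (simp add: linear_scale bounded_linear.linear[OF f])
  from this[of fst] this[of "\<lambda>p. fst (snd p)"] this[of "\<lambda>p. snd (snd p)"]
  have "(LINT p:S|lborel. p)
    = ((LINT p:S|lborel. fst p), (LINT p:S|lborel. fst (snd p)), (LINT p:S|lborel. snd (snd p)))"
    by (simp add: prod_eq_iff bounded_linear_fst bounded_linear_fst_comp bounded_linear_snd_comp bounded_linear_snd)
  then show ?thesis by (simp add: centroid_def)
qed

lemma paraboloid_segment_volume_centroid:
  assumes "0 < a"
  shows "volume (paraboloid_segment a) = a\<^sup>2 * pi / 2"
    and "centroid (paraboloid_segment a) = (0, 0, 2 / 3 * a)"
proof -
  let ?S = "oblique_segment 0 a (- sqrt a)"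
  have moments: "(LINT p:?S|lborel. 1) = a\<^sup>2 * pi / 2" "(LINT p:?S|lborel. fst p) = 0"
    "(LINT p:?S|lborel. fst (snd p)) = 0" "(LINT p:?S|lborel. snd (snd p)) = 2 / 3 * a * (a\<^sup>2 * pi / 2)"
    using oblique_segment_moments[of 0 a "- sqrt a"] assms by simp_all
  have vol: "volume ?S = a\<^sup>2 * pi / 2"
    by (simp only: volume_eq_set_integral moments)
  then show "volume (paraboloid_segment a) = a\<^sup>2 * pi / 2"
    by (simp only: paraboloid_segment_eq_oblique_segment[OF assms])
  show "centroid (paraboloid_segment a) = (0, 0, 2 / 3 * a)"
    unfolding paraboloid_segment_eq_oblique_segment[OF assms]
      centroid_compact[OF compact_oblique_segment] vol moments
    using assms by simp
qed

text \<open>Both pieces contribute the same \<open>4/15 A\<^bsup>5/2\<^esup>\<close> to the \<open>x\<close>-moment, which cancels. In the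
  \<open>z\<close>-moment the coefficients \<open>4/45 X\<close> and \<open>4/15 b + 4/45 (X - b/2)\<close> differ by \<open>2/9 b\<close>.\<close>

lemma submerged_left_moments:
  fixes a b c X :: real
  defines "A \<equiv> a - X\<^sup>2"
  defines "a' \<equiv> b\<^sup>2 / 4 - b * X + a"
  defines "V1 \<equiv> cap_volume a X"
  defines "V2 \<equiv> cap_volume a' (X - b / 2)"
  assumes "0 < a" "b < 0" and A: "0 < A" and c: "c = a - b * X"
  shows "volume (submerged_left a b c) = V1 - V2"
    and "(LINT p:submerged_left a b c|lborel. fst p) = - (b / 2) * V2"
    and "(LINT p:submerged_left a b c|lborel. fst (snd p)) = 0"
    and "(LINT p:submerged_left a b c|lborel. snd (snd p))
      = 2 / 3 * a * V1 - (b\<^sup>2 / 4 + 2 / 3 * a') * V2 - 2 / 9 * b * sqrt A ^ 5"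
proof -
  have r: "b\<^sup>2 / 4 + c = a'" by (simp add: a'_def c)
  \<comment> \<open>both pieces end at the same chord of the basis disk, whose squared half-length is \<open>A\<close>\<close>
  have rw: "a' - (X - b / 2)\<^sup>2 = A"
    by (simp add: a'_def A_def power2_eq_square algebra_simps)
  have le_sqrt: "- sqrt r \<le> w" "w \<le> sqrt r" if "w\<^sup>2 < r" for w r :: real
  proof -
    have "\<bar>w\<bar> < sqrt r" using that by (metis real_sqrt_abs real_sqrt_less_iff)
    then show "- sqrt r \<le> w" "w \<le> sqrt r" by auto
  qed
  have w1: "X\<^sup>2 < a" and w2: "(X - b / 2)\<^sup>2 < a'"
    using A rw by (auto simp: A_def)
  have "0 < a'" using w2 zero_le_power2[of "X - b / 2"] by linarith
  note upper = oblique_segment_moments[of 0 a X, simplified, OF \<open>0 < a\<close> le_sqrt[OF w1],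
      folded A_def V1_def]
  note lower = oblique_segment_moments[of b c X, unfolded r rw, OF \<open>0 < a'\<close> le_sqrt[OF w2],
      folded V2_def]
  note diff = set_integral_submerged_left[OF \<open>0 < a\<close> \<open>b < 0\<close> c]
  show "volume (submerged_left a b c) = V1 - V2"
    using diff[of "\<lambda>_. 1"] upper(1) lower(1) by (simp add: volume_eq_set_integral)
  show "(LINT p:submerged_left a b c|lborel. fst p) = - (b / 2) * V2"
    using diff[of fst] upper(2) lower(2) by (simp add: continuous_on_fst)
  show "(LINT p:submerged_left a b c|lborel. fst (snd p)) = 0"
    using diff[of "\<lambda>p. fst (snd p)"] upper(3) lower(3)
    by (simp add: continuous_on_fst continuous_on_snd)
  show "(LINT p:submerged_left a b c|lborel. snd (snd p))
      = 2 / 3 * a * V1 - (b\<^sup>2 / 4 + 2 / 3 * a') * V2 - 2 / 9 * b * sqrt A ^ 5"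
    using diff[of "\<lambda>p. snd (snd p)"] upper(4) lower(4)
    by (simp add: continuous_on_snd field_simps)
qed

text \<open>The \<open>z\<close>-component of the vector equation determines \<open>t\<close>; substituting it into the other two
  components and multiplying by the volume leaves conditions on moments alone.\<close>

lemma centroid_submerged_left_perpendicular_iff:
  assumes "0 < a" "b \<noteq> 0" and vol: "0 < volume (submerged_left a b c)"
  shows "(\<exists>t. centroid (paraboloid_segment a) - centroid (submerged_left a b c) = t *\<^sub>R (b, 0, - 1))
    \<longleftrightarrow> (LINT p:submerged_left a b c|lborel. fst (snd p)) = 0
      \<and> (LINT p:submerged_left a b c|lborel. fst p)
        = b * (2 / 3 * a * volume (submerged_left a b c) - (LINT p:submerged_left a b c|lborel. snd (snd p)))"
proof -
  define v where "v = volume (submerged_left a b c)"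
  obtain x y z where xyz: "(LINT p:submerged_left a b c|lborel. fst p) = x"
    "(LINT p:submerged_left a b c|lborel. fst (snd p)) = y"
    "(LINT p:submerged_left a b c|lborel. snd (snd p)) = z" by blast
  have "0 < v" using vol by (simp add: v_def)
  have "(\<exists>t. centroid (paraboloid_segment a) - centroid (submerged_left a b c) = t *\<^sub>R (b, 0, - 1))
    \<longleftrightarrow> (\<exists>t. - x / v = t * b \<and> y = 0 \<and> 2 / 3 * a - z / v = - t)"
    using \<open>0 < v\<close>
    by (simp add: paraboloid_segment_volume_centroid(2)[OF \<open>0 < a\<close>] xyz v_def[symmetric]
        centroid_compact[OF compact_submerged_left[OF \<open>0 < a\<close>]])
  also have "\<dots> \<longleftrightarrow> y = 0 \<and> - x / v = - (2 / 3 * a - z / v) * b"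
    by (metis minus_minus)
  also have "- x / v = - (2 / 3 * a - z / v) * b \<longleftrightarrow> x = b * (2 / 3 * a * v - z)"
    using \<open>0 < v\<close> by (simp add: field_simps)
  finally show ?thesis by (simp only: xyz v_def)
qed

theorem theorem1:
  fixes a \<sigma> b c X V A a' X' V1 V2 F E :: real
  assumes "a > 0" and "0 < \<sigma>" and "\<sigma> < 1" and "b < 0"
    and "- sqrt a < X" and "X < sqrt a"
    and "c = a - b * X"
    and "V = a\<^sup>2 * pi / 2"
    and "A = a - X\<^sup>2"
    and "a' = b\<^sup>2 / 4 - b * X + a"
    and "X' = X - b / 2"
    and "V1 = a\<^sup>2 / 2 * (pi / 2 - arctan (X / sqrt A)) + (2 * X ^ 3 - 5 * a * X) / 6 * sqrt A"
    and "V2 = a'\<^sup>2 / 2 * (pi / 2 - arctan (X' / sqrt A)) + (2 * X' ^ 3 - 5 * a' * X') / 6 * sqrt A"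
    and "F = V1 - V2 - \<sigma> * V"
    and "E = (5 * b\<^sup>2 / 12 - 2 * b * X / 3 + 1 / 2) * V2 + 2 * b / 9 * A powr (5 / 2)"
  shows "left_equilibrium a b c \<sigma> \<longleftrightarrow> F = 0 \<and> E = 0"
proof -
  let ?P = "submerged_left a b c"
  have A: "0 < A"
    using power2_less_of_between_sqrt[OF assms(5,6)] by (simp add: assms(9))
  have rw: "a' - X'\<^sup>2 = A"
    by (simp add: assms(9-11) power2_eq_square algebra_simps)
  have V1: "V1 = cap_volume a X" and V2: "V2 = cap_volume a' X'"
    using A rw cap_volume_arctan[of X a] cap_volume_arctan[of X' a'] by (simp_all add: assms(9,12,13))
  have "A powr (5 / 2) = (A powr (1 / 2)) powr real 5" by (simp add: powr_powr)
  also have "\<dots> = sqrt A ^ 5" using A by (subst powr_realpow) (simp_all add: powr_half_sqrt)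
  finally have E: "E = (5 * b\<^sup>2 / 12 - 2 * b * X / 3 + 1 / 2) * V2 + 2 * b / 9 * sqrt A ^ 5"
    by (simp add: assms(15))
  note mom = submerged_left_moments[OF assms(1,4) A[unfolded assms(9)] assms(7),
      folded assms(9) assms(10) assms(11), folded V1 V2]
  have "left_equilibrium a b c \<sigma> \<longleftrightarrow> F = 0
      \<and> (\<exists>t. centroid (paraboloid_segment a) - centroid ?P = t *\<^sub>R (b, 0, - 1))"
    by (simp add: left_equilibrium_def paraboloid_segment_volume_centroid(1)[OF assms(1)] mom(1)
        assms(8,14))
  \<comment> \<open>under \<open>F = 0\<close> the submerged volume is \<open>\<sigma> V > 0\<close>, so the centroid quotient is genuine\<close>
  moreover have "(\<exists>t. centroid (paraboloid_segment a) - centroid ?P = t *\<^sub>R (b, 0, - 1)) \<longleftrightarrow> E = 0"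
    if "F = 0"
  proof -
    have "volume ?P = \<sigma> * V" using that by (simp add: mom(1) assms(14))
    moreover have "0 < \<sigma> * V" using assms(1,2) by (simp add: assms(8))
    ultimately have "0 < volume ?P" by simp
    then have "(\<exists>t. centroid (paraboloid_segment a) - centroid ?P = t *\<^sub>R (b, 0, - 1)) \<longleftrightarrow>
        - (b / 2) * V2 = b * (2 / 3 * a * (V1 - V2)
          - (2 / 3 * a * V1 - (b\<^sup>2 / 4 + 2 / 3 * a') * V2 - 2 / 9 * b * sqrt A ^ 5))"
      using centroid_submerged_left_perpendicular_iff[of a b c] assms(1,4) by (simp add: mom)
    also have "\<dots> \<longleftrightarrow> b * E = 0"
    proof -
      have "b * (2 / 3 * a * (V1 - V2)
          - (2 / 3 * a * V1 - (b\<^sup>2 / 4 + 2 / 3 * a') * V2 - 2 / 9 * b * sqrt A ^ 5)) - (- (b / 2) * V2)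
        = b * E"
        by (simp add: E assms(10) power2_eq_square field_simps)
      then show ?thesis by linarith
    qed
    finally show ?thesis using assms(4) by simp
  qed
  ultimately show ?thesis by blast
qed

end
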